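(* Let $r\ge0$ and let $$c_n(z,D_{\mathrm{tr}},x_0)=\sup\{\mathrm E^n_D[L(z,y)\mid x=x_0]:\ D\in\mathcal D_n,\ B(D,D_{\mathrm{tr}})\le r\},\qquad z^r\in\arg\min_z c_n(z,D_{\mathrm{tr}},x_0),$$ be the robust formulation with bootstrap distance function $B$ and robustness radius $r$. Its bootstrap disappointment is at most $$b(n)=\sum_{j=1}^n\exp\left(-n\cdot\max\{r,r^j_n\}\right),\qquad r^j_n=\inf\{B(D,D_{\mathrm{tr}}):\ D\in\mathcal D^j_n\};$$ that is, $$D_{\mathrm{tr}}^\infty\left[\mathrm E^n_{D_{\mathrm{bs}[n]}}[L(z^r,y)\mid x=x_0]>c_n(z^r,D_{\mathrm{tr}},x_0)\right]\le b(n).$$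
   Context: Data. Let $\bar d_1=(\bar x_1,\bar y_1),\dots,\bar d_n=(\bar x_n,\bar y_n)$ be a fixed finite list (training data, $n\ge1$) of points in $\Omega\subseteq\mathbb R^{\dim(x)}\times\mathbb R^{\dim(y)}$, $\Omega_n$ the finite set of distinct points in the list, $\mathcal D_n$ the set of all probability distributions on $\Omega_n$, and $D_{\mathrm{tr}}=\frac1n\sum_{i=1}^n\delta_{\bar d_i}$. Fix a context of interest $x_0\in\mathbb R^{\dim(x)}$. Neighborhoods. $\mathrm{dist}(\bar d,x_0)\ge0$ satisfies $\mathrm{dist}(\bar d,x_0)=\mathrm{dist}(\bar d',x_0)\iff\bar d=\bar d'$. For $j\in\{1,\dots,n\}$ let $R^j_n=\min\{\rho\ge0:\ |\{i\le n:\mathrm{dist}(\bar d_i,x_0)\le\rho\}|\ge j\}$ (counted with multiplicity) and $N^j_n(x_0)=\{\bar d\in\Omega_n:\mathrm{dist}(\bar d,x_0)\le R^j_n\}$; put $N^0_n(x_0)=\emptyset$. Weights and loss. $w_n(\bar x,x_0)>0$ is a positive weighing function. $L(z,\bar y)\in\mathbb R_+\cup\{+\infty\}$ is convex in the decision $z\in\mathbb R^{\dim(z)}$ for each $\bar y$ and measurable in $\bar y$ for each $z$. Conventions: $0\cdot(+\infty)=0$, $\sup\emptyset=-\infty$, $\inf\emptyset=+\infty$, $\exp(-\infty)=0$. Fix $k\in\{1,\dots,n\}$. Estimator. For $D\in\mathcal D_n$ and $j\in\{1,\dots,n\}$ the partial estimator $\mathrm E^{n,j}_D[L(z,y)\mid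 x=x_0]$ is the supremum of $\sum_{N^j_n(x_0)}w_n(\bar x,x_0)L(z,\bar y)P[\bar x,\bar y]$ over $s>0$ and $P:\Omega_n\to[0,\infty)$ subject to $s\,D=P$ on $\Omega_n$, $\sum_{\Omega_n}P=s$, $\sum_{N^j_n(x_0)}w_n(\bar x,x_0)P[\bar x,\bar y]=1$, $\sum_{N^j_n(x_0)}P\ge\frac kn s$, $\sum_{N^{j-1}_n(x_0)}P\le\frac{k-1}n s$. The estimator is $\mathrm E^n_D[L(z,y)\mid x=x_0]=\max_{j\in\{1,\dots,n\}}\mathrm E^{n,j}_D[L(z,y)\mid x=x_0]$. For the empirical distribution $D$ of a data list of length $n$ with entries in $\Omega_n$ this equals $\sum_{N_D}L(z,\bar y)w_n(\bar x,x_0)D[\bar x,\bar y]\big/\sum_{N_D}w_n(\bar x,x_0)D[\bar x,\bar y]$, where $N_D$ is the smallest $N^j_n(x_0)$ containing at least $k$ of the $n$ observations of that list. Sets. $\mathcal D^j_n=\{D\in\mathcal D_n:\ \sum_{N^{j-1}_n(x_0)}D[\bar x,\bar y]\le\frac{k-1}n<\frac kn\le\sum_{N^j_n(x_0)}D[\bar x,\bar y]\}$. Bootstrap distance. $B(D,D')=\sum_{(\bar x,\bar y)\in\Omega_n}D[\bar x,\bar y]\log\left(D[\bar x,\bar y]/D'[\bar x,\bar y]\right)$ for $D,D'\in\mathcal D_n$ (relative entropy, usual conventions $0\log0=0$, value $+\infty$ if $D\not\ll D'$). Bootstrap. $D_{\mathrm{tr}}^\infty$ is the law of an i.i.d. sequence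 with marginal $D_{\mathrm{tr}}$ (resampling with replacement from the training data), and $D_{\mathrm{bs}[n]}$ is the empirical distribution of the first $n$ terms of that sequence. *)

theory Defs
  imports "HOL-Probability.Probability"
begin

text \<open>
  Throughout, the training data are \<open>d 1, \<dots>, d n\<close> (repetitions allowed), \<open>\<delta> p x0\<close> is the distance
  of a data point \<open>p\<close> to the context \<open>x0\<close>, and distributions on a finite set of points are pmfs
  whose support lies in that set.
\<close>

definition exp_ereal :: "ereal \<Rightarrow> ereal" where
  "exp_ereal t = (case t of ereal x \<Rightarrow> ereal (exp x) | PInfty \<Rightarrow> \<infinity> | MInfty \<Rightarrow> 0)"

text \<open>In \<^typ>\<open>ereal\<close> one has \<open>0 * \<infinity> = 0\<close>, so the cases \<open>u = 0\<close> and \<open>v = 0\<close> impose nothing.\<close>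

definition ereal_convex :: "('z::real_vector \<Rightarrow> ereal) \<Rightarrow> bool" where
  "ereal_convex f \<longleftrightarrow>
     (\<forall>z1 z2 u v. 0 \<le> u \<longrightarrow> 0 \<le> v \<longrightarrow> u + v = 1 \<longrightarrow>
        f (u *\<^sub>R z1 + v *\<^sub>R z2) \<le> ereal u * f z1 + ereal v * f z2)"

definition data_points :: "nat \<Rightarrow> (nat \<Rightarrow> 'p) \<Rightarrow> 'p set" where
  "data_points n d = d ` {1..n}"

definition data_dists :: "nat \<Rightarrow> (nat \<Rightarrow> 'p) \<Rightarrow> 'p pmf set" where
  "data_dists n d = {D. set_pmf D \<subseteq> data_points n d}"

definition train_dist :: "nat \<Rightarrow> (nat \<Rightarrow> 'p) \<Rightarrow> 'p pmf" where
  "train_dist n d = map_pmf d (pmf_of_set {1..n})"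

text \<open>The minimum below is attained whenever \<open>j \<le> n\<close>.\<close>

definition nn_radius ::
  "('x \<times> 'y \<Rightarrow> 'x \<Rightarrow> real) \<Rightarrow> 'x \<Rightarrow> nat \<Rightarrow> (nat \<Rightarrow> 'x \<times> 'y) \<Rightarrow> nat \<Rightarrow> real" where
  "nn_radius \<delta> x0 n d j = (LEAST \<rho>. 0 \<le> \<rho> \<and> j \<le> card {i \<in> {1..n}. \<delta> (d i) x0 \<le> \<rho>})"

definition nbhd ::
  "('x \<times> 'y \<Rightarrow> 'x \<Rightarrow> real) \<Rightarrow> 'x \<Rightarrow> nat \<Rightarrow> (nat \<Rightarrow> 'x \<times> 'y) \<Rightarrow> nat \<Rightarrow> ('x \<times> 'y) set" where
  "nbhd \<delta> x0 n d j =
     (if j = 0 then {} else {p \<in> data_points n d. \<delta> p x0 \<le> nn_radius \<delta> x0 n d j})"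

text \<open>
  The decision variable \<open>P\<close> is a total function of which only the values on the data points
  matter. In \<^typ>\<open>ereal\<close> the supremum of the empty set is \<open>-\<infinity>\<close>.
\<close>

definition partial_estimator ::
  "('x \<times> 'y \<Rightarrow> 'x \<Rightarrow> real) \<Rightarrow> ('x \<Rightarrow> 'x \<Rightarrow> real) \<Rightarrow> ('z \<Rightarrow> 'y \<Rightarrow> ereal) \<Rightarrow> 'x \<Rightarrow> nat \<Rightarrow> nat \<Rightarrow>
   (nat \<Rightarrow> 'x \<times> 'y) \<Rightarrow> nat \<Rightarrow> ('x \<times> 'y) pmf \<Rightarrow> 'z \<Rightarrow> ereal" where
  "partial_estimator \<delta> w L x0 k n d j D z =
     Sup {(\<Sum>(x, y)\<in>nbhd \<delta> x0 n d j. ereal (w x x0) * L z y * ereal (P (x, y))) | s P.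
        0 < s \<and>
        (\<forall>p\<in>data_points n d. 0 \<le> P p) \<and>
        (\<forall>p\<in>data_points n d. s * pmf D p = P p) \<and>
        (\<Sum>p\<in>data_points n d. P p) = s \<and>
        (\<Sum>(x, y)\<in>nbhd \<delta> x0 n d j. w x x0 * P (x, y)) = 1 \<and>
        (\<Sum>p\<in>nbhd \<delta> x0 n d j. P p) \<ge> real k / real n * s \<and>
        (\<Sum>p\<in>nbhd \<delta> x0 n d (j - 1). P p) \<le> (real k - 1) / real n * s}"

definition estimator ::
  "('x \<times> 'y \<Rightarrow> 'x \<Rightarrow> real) \<Rightarrow> ('x \<Rightarrow> 'x \<Rightarrow> real) \<Rightarrow> ('z \<Rightarrow> 'y \<Rightarrow> ereal) \<Rightarrow> 'x \<Rightarrow> nat \<Rightarrow> nat \<Rightarrow>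
   (nat \<Rightarrow> 'x \<times> 'y) \<Rightarrow> ('x \<times> 'y) pmf \<Rightarrow> 'z \<Rightarrow> ereal" where
  "estimator \<delta> w L x0 k n d D z =
     Max ((\<lambda>j. partial_estimator \<delta> w L x0 k n d j D z) ` {1..n})"

definition partial_dists ::
  "('x \<times> 'y \<Rightarrow> 'x \<Rightarrow> real) \<Rightarrow> 'x \<Rightarrow> nat \<Rightarrow> nat \<Rightarrow> (nat \<Rightarrow> 'x \<times> 'y) \<Rightarrow> nat \<Rightarrow> ('x \<times> 'y) pmf set" where
  "partial_dists \<delta> x0 k n d j =
     {D \<in> data_dists n d.
        (\<Sum>p\<in>nbhd \<delta> x0 n d (j - 1). pmf D p) \<le> (real k - 1) / real n \<and>
        real k / real n \<le> (\<Sum>p\<in>nbhd \<delta> x0 n d j. pmf D p)}"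

text \<open>The convention \<open>0 log 0 = 0\<close> holds because of the factor \<open>pmf D p\<close>.\<close>

definition bootstrap_distance ::
  "nat \<Rightarrow> (nat \<Rightarrow> 'p) \<Rightarrow> 'p pmf \<Rightarrow> 'p pmf \<Rightarrow> ereal" where
  "bootstrap_distance n d D D' =
     (if set_pmf D \<subseteq> set_pmf D'
      then ereal (\<Sum>p\<in>data_points n d. pmf D p * ln (pmf D p / pmf D' p))
      else \<infinity>)"

definition robust_cost ::
  "('x \<times> 'y \<Rightarrow> 'x \<Rightarrow> real) \<Rightarrow> ('x \<Rightarrow> 'x \<Rightarrow> real) \<Rightarrow> ('z \<Rightarrow> 'y \<Rightarrow> ereal) \<Rightarrow> 'x \<Rightarrow> nat \<Rightarrow> nat \<Rightarrow>
   (nat \<Rightarrow> 'x \<times> 'y) \<Rightarrow> real \<Rightarrow> 'z \<Rightarrow> ereal" where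
  "robust_cost \<delta> w L x0 k n d r z =
     Sup {estimator \<delta> w L x0 k n d D z | D.
        D \<in> data_dists n d \<and> bootstrap_distance n d D (train_dist n d) \<le> ereal r}"

definition partial_radius ::
  "('x \<times> 'y \<Rightarrow> 'x \<Rightarrow> real) \<Rightarrow> 'x \<Rightarrow> nat \<Rightarrow> nat \<Rightarrow> (nat \<Rightarrow> 'x \<times> 'y) \<Rightarrow> nat \<Rightarrow> ereal" where
  "partial_radius \<delta> x0 k n d j =
     Inf {bootstrap_distance n d D (train_dist n d) | D. D \<in> partial_dists \<delta> x0 k n d j}"

definition disappointment_bound ::
  "('x \<times> 'y \<Rightarrow> 'x \<Rightarrow> real) \<Rightarrow> 'x \<Rightarrow> nat \<Rightarrow> nat \<Rightarrow> (nat \<Rightarrow> 'x \<times> 'y) \<Rightarrow> real \<Rightarrow> ereal" where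
  "disappointment_bound \<delta> x0 k n d r =
     (\<Sum>j = 1..n. exp_ereal (- (ereal (real n) * max (ereal r) (partial_radius \<delta> x0 k n d j))))"

definition bootstrap_measure :: "nat \<Rightarrow> (nat \<Rightarrow> 'p) \<Rightarrow> (nat \<Rightarrow> 'p) measure" where
  "bootstrap_measure n d = (\<Pi>\<^sub>M i\<in>(UNIV :: nat set). measure_pmf (train_dist n d))"

text \<open>Resampled sequences are indexed from 0.\<close>

definition empirical_dist :: "nat \<Rightarrow> (nat \<Rightarrow> 'p) \<Rightarrow> 'p pmf" where
  "empirical_dist n \<omega> = map_pmf \<omega> (pmf_of_set {..<n})"

text \<open>
  A pmf lives on the full power set, and the product sigma-algebra over an uncountable type
  does not contain every event on finitely many coordinates. Since \<^const>\<open>measure\<close> is 0 on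
  non-measurable sets, we check that the disappointment event is measurable: the estimator
  depends on the resampled sequence only through which of the first \<open>n\<close> terms equal which
  data point.
\<close>

lemma estimator_cong:
  assumes "\<And>p. p \<in> data_points n d \<Longrightarrow> pmf D p = pmf D' p"
  shows "estimator \<delta> w L x0 k n d D z = estimator \<delta> w L x0 k n d D' z"
  unfolding estimator_def partial_estimator_def using assms by (simp cong: ball_cong)

lemma pmf_empirical_dist:
  assumes "n \<ge> 1"
  shows "pmf (empirical_dist n \<omega>) p = card {i \<in> {..<n}. \<omega> i = p} / n"
proof -
  have "{..<n} \<inter> \<omega> -` {p} = {i \<in> {..<n}. \<omega> i = p}" by auto
  then show ?thesis
    using assms
    by (subst empirical_dist_def, subst pmf_map, subst measure_pmf_of_set)
       (auto simp: lessThan_empty_iff)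
qed

lemma disappointment_event_measurable:
  assumes "n \<ge> 1"
  shows "{\<omega> \<in> space (bootstrap_measure n d).
           estimator \<delta> w L x0 k n d (empirical_dist n \<omega>) z > c} \<in> sets (bootstrap_measure n d)"
proof -
  let ?M = "bootstrap_measure n d"
  let ?E = "\<lambda>\<omega>. estimator \<delta> w L x0 k n d (empirical_dist n \<omega>) z > c"
  define I where "I = {..<n} \<times> data_points n d"
  define S where "S = (\<lambda>\<omega>. {(i, p) \<in> I. \<omega> i = p})"
  have fin: "finite I" by (simp add: I_def data_points_def)
  have E_cong: "?E \<omega> = ?E \<omega>'" if "S \<omega> = S \<omega>'" for \<omega> \<omega>'
  proof -
    have "{i \<in> {..<n}. \<omega> i = p} = {i \<in> {..<n}. \<omega>' i = p}" if p: "p \<in> data_points n d" for p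
    proof -
      have "{i \<in> {..<n}. \<eta> i = p} = {i. (i, p) \<in> S \<eta>}" for \<eta> :: "nat \<Rightarrow> 'a \<times> 'b"
        using p by (auto simp: S_def I_def)
      then show ?thesis using that \<open>S \<omega> = S \<omega>'\<close> by simp
    qed
    then have "estimator \<delta> w L x0 k n d (empirical_dist n \<omega>) z =
               estimator \<delta> w L x0 k n d (empirical_dist n \<omega>') z"
      using assms by (intro estimator_cong) (simp add: pmf_empirical_dist)
    then show ?thesis by simp
  qed
  have sets_S: "{\<omega> \<in> space ?M. S \<omega> = T} \<in> sets ?M" if "T \<subseteq> I" for T
  proof -
    have "{\<omega> \<in> space ?M. S \<omega> = T} =
          {\<omega> \<in> space ?M. \<forall>q\<in>I. \<omega> (fst q) \<in> (if q \<in> T then {snd q} else - {snd q})}"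
      using that by (auto simp: S_def split: if_splits)
    moreover have "(\<lambda>\<omega>. \<omega> i) \<in> ?M \<rightarrow>\<^sub>M count_space UNIV" for i
    proof -
      have "(\<lambda>\<omega>. \<omega> i) \<in> ?M \<rightarrow>\<^sub>M measure_pmf (train_dist n d)"
        unfolding bootstrap_measure_def by (rule measurable_component_singleton) simp
      then show ?thesis by (simp add: measurable_cong_sets)
    qed
    then have "{\<omega> \<in> space ?M. \<omega> i \<in> A} \<in> sets ?M" for i A
      by (rule measurable_sets_Collect) simp
    then have "{\<omega> \<in> space ?M. \<forall>q\<in>I. \<omega> (fst q) \<in> (if q \<in> T then {snd q} else - {snd q})}
               \<in> sets ?M"
      using fin by (intro sets.sets_Collect_finite_All) auto
    ultimately show ?thesis by simp
  qed
  have "{\<omega> \<in> space ?M. ?E \<omega>} =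
        (\<Union>T\<in>{T. T \<subseteq> I \<and> (\<exists>\<omega>. S \<omega> = T \<and> ?E \<omega>)}. {\<omega> \<in> space ?M. S \<omega> = T})"
  proof (intro set_eqI iffI)
    fix \<omega> assume "\<omega> \<in> {\<omega> \<in> space ?M. ?E \<omega>}"
    moreover have "S \<omega> \<subseteq> I" by (auto simp: S_def)
    ultimately show "\<omega> \<in> (\<Union>T\<in>{T. T \<subseteq> I \<and> (\<exists>\<omega>. S \<omega> = T \<and> ?E \<omega>)}. {\<omega> \<in> space ?M. S \<omega> = T})"
      by auto
  next
    fix \<omega> assume "\<omega> \<in> (\<Union>T\<in>{T. T \<subseteq> I \<and> (\<exists>\<omega>. S \<omega> = T \<and> ?E \<omega>)}. {\<omega> \<in> space ?M. S \<omega> = T})"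
    then obtain \<omega>' where "\<omega> \<in> space ?M" "S \<omega>' = S \<omega>" "?E \<omega>'" by auto
    then show "\<omega> \<in> {\<omega> \<in> space ?M. ?E \<omega>}" using E_cong by blast
  qed
  also have "\<dots> \<in> sets ?M"
    using fin sets_S by (intro sets.finite_UN) (auto intro: finite_subset[of _ "Pow I"])
  finally show ?thesis .
qed

end

theory Submission
  imports Defs
begin

text \<open>
  The bound is a finite-sample large deviation inequality for convex sets of distributions,
  applied once for each \<open>j\<close>. The disappointment event is a union over \<open>j\<close>, because the estimator is
  the maximum of the partial estimators. On the convex polytope of distributions that are feasible
  for a given \<open>j\<close>, the partial estimator is a ratio of two linear functions of \<open>D\<close>, so it is
  quasiconcave and each of its superlevel sets is convex
  (\<open>partial_dists_bind\<close>, \<open>partial_estimator_quasiconcave\<close>); elsewhere it is \<open>-\<infinity>\<close>.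

  Let \<open>G\<close> be the set of resamples whose \<open>j\<close>th partial estimator exceeds the robust cost, and,
  unless \<open>G\<close> has probability 0, let \<open>Q\<close> be the mean empirical distribution of a resample conditioned
  on \<open>G\<close>. By convexity \<open>Q\<close> is
  itself feasible for \<open>j\<close> and its estimator exceeds the robust cost. The first fact gives
  \<open>B(Q, D_tr) \<ge> r_j\<close>; the second gives \<open>B(Q, D_tr) > r\<close>, since the robust cost dominates the estimator
  on the whole ball of radius \<open>r\<close>. It remains to see that \<open>G\<close> has probability at most
  \<open>exp (- n B(Q, D_tr))\<close> (\<open>conditioned_sample_entropy_bound\<close>). This is Csiszar's argument: the
  conditional law of the resample has relative entropy \<open>- ln (Prob G)\<close> with respect to the unconditional
  one, and comparing it with the product of \<open>n\<close> copies of \<open>Q\<close> by Gibbs' inequality shows that this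
  entropy is at least \<open>n B(Q, D_tr)\<close>.
\<close>

section \<open>Relative entropy of conditioned samples\<close>

text \<open>From \<open>ln t \<le> t - 1\<close> at \<open>t = q(x) / p(x)\<close>, averaged over \<open>p\<close>.\<close>

lemma gibbs_inequality:
  fixes p q :: "'a pmf"
  assumes fin: "finite (set_pmf p)" and sub: "set_pmf p \<subseteq> set_pmf q"
  shows "0 \<le> measure_pmf.expectation p (\<lambda>x. ln (pmf p x / pmf q x))"
proof -
  have "- ln (pmf p x / pmf q x) * pmf p x \<le> pmf q x - pmf p x" if "x \<in> set_pmf p" for x
  proof -
    have pos: "0 < pmf p x" "0 < pmf q x"
      using that sub by (auto simp: pmf_positive)
    have "- ln (pmf p x / pmf q x) = ln (pmf q x / pmf p x)"
      using pos by (simp add: ln_div)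
    also have "\<dots> \<le> pmf q x / pmf p x - 1"
      using pos by (intro ln_le_minus_one) simp
    finally have "- ln (pmf p x / pmf q x) * pmf p x \<le> (pmf q x / pmf p x - 1) * pmf p x"
      using pos by (intro mult_right_mono) auto
    also have "(pmf q x / pmf p x - 1) * pmf p x = pmf q x - pmf p x"
      using pos by (simp add: left_diff_distrib)
    finally show ?thesis .
  qed
  then have "(\<Sum>x\<in>set_pmf p. - ln (pmf p x / pmf q x) * pmf p x)
             \<le> (\<Sum>x\<in>set_pmf p. pmf q x) - (\<Sum>x\<in>set_pmf p. pmf p x)"
    unfolding sum_subtractf[symmetric] by (rule sum_mono)
  also have "\<dots> \<le> 0"
    using fin by (simp add: sum_pmf_eq_1 measure_measure_pmf_finite[symmetric])
  finally show ?thesis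
    using fin by (subst integral_measure_pmf_real[of "set_pmf p"]) (auto simp: sum_negf)
qed

lemma expectation_empirical_dist:
  fixes h :: "'a \<Rightarrow> real"
  assumes "n \<ge> 1"
  shows "measure_pmf.expectation (empirical_dist n x) h = (\<Sum>i<n. h (x i)) / n"
  using assms unfolding empirical_dist_def integral_map_pmf
  by (subst integral_pmf_of_set) (auto simp: lessThan_empty_iff)

lemma set_empirical_dist:
  "n \<ge> 1 \<Longrightarrow> set_pmf (empirical_dist n x) = x ` {..<n}"
  unfolding empirical_dist_def set_map_pmf by (subst set_pmf_of_set) (auto simp: lessThan_empty_iff)

text \<open>
  With \<open>q\<close> the law of the sample conditioned on \<open>G\<close> and \<open>m\<close> the product of \<open>n\<close> copies of \<open>Q\<close>,
  the density of \<open>q\<close> with respect to \<open>m\<close> at \<open>x\<close> is \<open>1 / Prob G\<close> times the product of the ratios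
  \<open>P(x_i) / Q(x_i)\<close>. Its logarithm is therefore \<open>- ln (Prob G)\<close> minus a sum over the entries of \<open>x\<close>,
  and the \<open>q\<close>-mean of that sum is \<open>n\<close> times a mean under \<open>Q\<close>, precisely because \<open>Q\<close> is the mean of the
  empirical distributions. Gibbs' inequality makes the total nonnegative.
\<close>

lemma conditioned_sample_entropy_bound:
  fixes P :: "'a pmf"
  assumes n: "n \<ge> 1" and fin: "finite (set_pmf P)"
  defines "R \<equiv> Pi_pmf {..<n} undefined (\<lambda>_. P)"
  assumes G: "set_pmf R \<inter> G \<noteq> {}"
  defines "Q \<equiv> cond_pmf R G \<bind> empirical_dist n"
  shows "measure_pmf.prob R G \<le>
         exp (- (real n * measure_pmf.expectation Q (\<lambda>p. ln (pmf Q p / pmf P p))))"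
proof -
  define q where "q = cond_pmf R G"
  define m where "m = Pi_pmf {..<n} undefined (\<lambda>_. Q)"
  define g where "g = (\<lambda>p. ln (pmf Q p / pmf P p))"
  have setR: "set_pmf R = PiE_dflt {..<n} undefined (\<lambda>_. set_pmf P)"
    by (simp add: R_def set_Pi_pmf comp_def)
  have finR: "finite (set_pmf R)"
    unfolding setR using fin by blast
  have setq: "set_pmf q = set_pmf R \<inter> G"
    unfolding q_def using G by (rule set_cond_pmf)
  have finq: "finite (set_pmf q)" using finR setq by simp
  have in_Q: "x i \<in> set_pmf Q" if "x \<in> set_pmf q" "i < n" for x i
    using that n unfolding Q_def q_def[symmetric] by (auto simp: set_empirical_dist)
  have in_P: "x i \<in> set_pmf P" if "x \<in> set_pmf q" "i < n" for x i
    using that unfolding setq setR by (auto simp: PiE_dflt_def)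
  have dflt: "x i = undefined" if "x \<in> set_pmf q" "i \<notin> {..<n}" for x i
    using that unfolding setq setR by (auto simp: PiE_dflt_def)
  \<comment> \<open>Every entry of a sample in the support of \<open>q\<close> has positive mass under \<open>Q\<close>, so the logarithms
     below are those of positive numbers.\<close>
  have sub: "set_pmf q \<subseteq> set_pmf m"
    using in_Q dflt by (auto simp: m_def set_Pi_pmf PiE_dflt_def)
  have piPos: "0 < measure_pmf.prob R G"
    using G by (simp add: measure_measure_pmf_not_zero order_less_le) 
  have ln_ratio: "ln (pmf q x / pmf m x) = - ln (measure_pmf.prob R G) - (\<Sum>i<n. g (x i))"
    if x: "x \<in> set_pmf q" for x
  proof -
    have "pmf q x = pmf R x / measure_pmf.prob R G"
      using x G setq by (simp add: q_def pmf_cond)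
    moreover have "pmf R x = (\<Prod>i<n. pmf P (x i))" and "pmf m x = (\<Prod>i<n. pmf Q (x i))"
      using dflt[OF x] by (simp_all add: R_def m_def pmf_Pi)
    moreover have "\<And>i. i < n \<Longrightarrow> 0 < pmf P (x i)" "\<And>i. i < n \<Longrightarrow> 0 < pmf Q (x i)"
      using in_P[OF x] in_Q[OF x] by (auto simp: pmf_positive)
    moreover have "ln (\<Prod>i<n. pmf P (x i)) - ln (\<Prod>i<n. pmf Q (x i)) = - (\<Sum>i<n. g (x i))"
    proof -
      have "(\<Sum>i<n. g (x i)) = (\<Sum>i<n. ln (pmf Q (x i)) - ln (pmf P (x i)))"
        unfolding g_def using calculation(4,5) by (intro sum.cong refl ln_divide_pos) auto
      then show ?thesis
        using calculation(4,5) by (subst (1 2) ln_prod) (force simp: sum_subtractf)+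
    qed
    moreover have "0 < (\<Prod>i<n. pmf P (x i))" "0 < (\<Prod>i<n. pmf Q (x i))"
      using calculation(4,5) by (auto intro!: prod_pos)
    ultimately show ?thesis
      using piPos by (simp add: ln_divide_pos ln_mult_pos)
  qed
  have "0 \<le> measure_pmf.expectation q (\<lambda>x. ln (pmf q x / pmf m x))"
    using finq sub by (rule gibbs_inequality)
  also have "\<dots> = measure_pmf.expectation q (\<lambda>x. - ln (measure_pmf.prob R G) - (\<Sum>i<n. g (x i)))"
    by (intro integral_cong_AE) (auto simp: AE_measure_pmf_iff ln_ratio)
  also have "\<dots> = - ln (measure_pmf.prob R G) - measure_pmf.expectation q (\<lambda>x. \<Sum>i<n. g (x i))"
    using finq by (subst Bochner_Integration.integral_diff) (auto intro: integrable_measure_pmf_finite)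
  also have "measure_pmf.expectation q (\<lambda>x. \<Sum>i<n. g (x i)) =
             real n * measure_pmf.expectation Q g"
  proof -
    have "measure_pmf.expectation Q g =
          (\<Sum>x\<in>set_pmf q. pmf q x * ((\<Sum>i<n. g (x i)) / n))"
      unfolding Q_def q_def[symmetric] using n finq
      by (subst pmf_expectation_bind[of "set_pmf q"])
         (auto simp: expectation_empirical_dist set_empirical_dist)
    also have "real n * \<dots> = (\<Sum>x\<in>set_pmf q. (\<Sum>i<n. g (x i)) * pmf q x)"
      unfolding sum_distrib_left using n by (intro sum.cong) auto
    also have "\<dots> = measure_pmf.expectation q (\<lambda>x. \<Sum>i<n. g (x i))"
      using finq by (subst integral_measure_pmf_real[of "set_pmf q"]) auto
    finally show ?thesis by simp
  qed
  finally have "ln (measure_pmf.prob R G) \<le> - (real n * measure_pmf.expectation Q g)"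
    by simp
  then show ?thesis
    using piPos unfolding g_def by (metis exp_le_cancel_iff exp_ln)
qed

text \<open>
  This replaces the infinite product space by a pmf on \<open>n\<close>-tuples, where every event has a
  probability and the union bound over \<open>j\<close> raises no measurability question. An inequality is enough,
  and it holds for non-measurable events as well because they have measure 0 by default. Almost every
  sequence lies in one of the finitely many cylinders over the support of the \<open>n\<close>-tuple.
\<close>

lemma prob_iid_sequence_le_Pi_pmf:
  fixes P :: "'a pmf" and \<Phi> :: "(nat \<Rightarrow> 'a) \<Rightarrow> bool"
  assumes fin: "finite (set_pmf P)"
    and cong: "\<And>\<omega> \<omega>'. (\<And>i. i < n \<Longrightarrow> \<omega> i = \<omega>' i) \<Longrightarrow> \<Phi> \<omega> = \<Phi> \<omega>'"
  shows "\<P>(\<omega> in PiM UNIV (\<lambda>_. measure_pmf P). \<Phi> \<omega>)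
         \<le> measure_pmf.prob (Pi_pmf {..<n} undefined (\<lambda>_. P)) {x. \<Phi> x}"
proof -
  let ?M = "PiM (UNIV :: nat set) (\<lambda>_. measure_pmf P)"
  interpret M: product_prob_space "\<lambda>_::nat. measure_pmf P" UNIV ..
  define R where "R = Pi_pmf {..<n} undefined (\<lambda>_. P)"
  define cyl where "cyl = (\<lambda>x. {\<omega> \<in> space ?M. \<forall>i\<in>{..<n}. \<omega> i \<in> {x i}})"
  have setR: "set_pmf R = PiE_dflt {..<n} undefined (\<lambda>_. set_pmf P)"
    by (simp add: R_def set_Pi_pmf comp_def)
  have finR: "finite (set_pmf R)"
    unfolding setR using fin by blast
  have sets_cyl: "cyl x \<in> sets ?M" for x
  proof -
    have "{\<omega> \<in> space ?M. \<omega> i \<in> {x i}} \<in> sets ?M" for i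
      by (rule sets_Collect_single') auto
    then show ?thesis
      unfolding cyl_def by (intro sets.sets_Collect_finite_All) auto
  qed
  have prob_cyl: "measure ?M (cyl x) = pmf R x" if "x \<in> set_pmf R" for x
  proof -
    have "emeasure ?M (cyl x) = (\<Prod>i<n. emeasure (measure_pmf P) {x i})"
      unfolding cyl_def by (rule M.emeasure_PiM_Collect) auto
    also have "\<dots> = ennreal (\<Prod>i<n. pmf P (x i))"
      by (simp add: emeasure_pmf_single prod_ennreal)
    finally show ?thesis
      using that unfolding setR
      by (auto simp: measure_def R_def pmf_Pi PiE_dflt_def prod_nonneg)
  qed
  have supp: "AE \<omega> in ?M. \<forall>i\<in>{..<n}. \<omega> i \<in> set_pmf P"
    by (intro AE_finite_allI M.AE_component) (auto simp: AE_measure_pmf_iff)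
  have "\<P>(\<omega> in ?M. \<Phi> \<omega>) \<le> measure ?M (\<Union>x\<in>set_pmf R \<inter> {x. \<Phi> x}. cyl x)"
  proof (rule M.finite_measure_mono_AE)
    show "AE \<omega> in ?M. \<omega> \<in> {\<omega> \<in> space ?M. \<Phi> \<omega>} \<longrightarrow> \<omega> \<in> (\<Union>x\<in>set_pmf R \<inter> {x. \<Phi> x}. cyl x)"
      using supp
    proof eventually_elim
      case (elim \<omega>)
      have "restrict \<omega> {..<n} \<in> set_pmf R"
        using elim by (auto simp: setR PiE_dflt_def)
      moreover have "\<Phi> (restrict \<omega> {..<n}) = \<Phi> \<omega>"
        by (rule cong) simp
      ultimately show ?case
        by (auto simp: cyl_def intro!: bexI[of _ "restrict \<omega> {..<n}"])
    qed
    show "(\<Union>x\<in>set_pmf R \<inter> {x. \<Phi> x}. cyl x) \<in> sets ?M"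
      using finR sets_cyl by (intro sets.finite_UN) auto
  qed
  also have "\<dots> \<le> (\<Sum>x\<in>set_pmf R \<inter> {x. \<Phi> x}. measure ?M (cyl x))"
    using finR sets_cyl by (intro M.finite_measure_subadditive_finite) auto
  also have "\<dots> = (\<Sum>x\<in>set_pmf R \<inter> {x. \<Phi> x}. pmf R x)"
    by (intro sum.cong) (auto simp: prob_cyl)
  also have "\<dots> = measure_pmf.prob R (set_pmf R \<inter> {x. \<Phi> x})"
    using finR by (simp add: measure_measure_pmf_finite)
  also have "\<dots> \<le> measure_pmf.prob R {x. \<Phi> x}"
    by (intro measure_pmf.finite_measure_mono) auto
  finally show ?thesis unfolding R_def .
qed

section \<open>Mixtures of distributions on the data\<close>

lemma finite_data_points: "finite (data_points n d)"
  by (simp add: data_points_def)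

lemma nbhd_subset_data_points: "nbhd \<delta> x0 n d j \<subseteq> data_points n d"
  by (auto simp: nbhd_def)

lemma finite_nbhd: "finite (nbhd \<delta> x0 n d j)"
  using nbhd_subset_data_points finite_data_points by (rule finite_subset)

lemma set_train_dist: "n \<ge> 1 \<Longrightarrow> set_pmf (train_dist n d) = data_points n d"
  unfolding train_dist_def data_points_def set_map_pmf by (subst set_pmf_of_set) auto

lemma pmf_bind_finite:
  assumes "finite (set_pmf q)"
  shows "pmf (q \<bind> F) p = (\<Sum>x\<in>set_pmf q. pmf q x * pmf (F x) p)"
  using assms unfolding pmf_bind
  by (subst integral_measure_pmf_real[of "set_pmf q"]) (auto simp: mult.commute)

lemma sum_pmf_bind:
  fixes h :: "'a \<Rightarrow> real"
  assumes "finite (set_pmf q)"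
  shows "(\<Sum>p\<in>A. h p * pmf (q \<bind> F) p) =
         (\<Sum>x\<in>set_pmf q. pmf q x * (\<Sum>p\<in>A. h p * pmf (F x) p))"
  unfolding pmf_bind_finite[OF assms] sum_distrib_left
  by (subst sum.swap) (simp add: mult_ac)

text \<open>
  Losses may be infinite, so the linearity of the mean is also needed for extended nonnegative
  coefficients.
\<close>

lemma sum_pmf_bind_ereal:
  fixes h :: "'a \<Rightarrow> ereal"
  assumes "finite (set_pmf q)" and "\<And>p. p \<in> A \<Longrightarrow> 0 \<le> h p"
  shows "(\<Sum>p\<in>A. h p * ereal (pmf (q \<bind> F) p)) =
         (\<Sum>x\<in>set_pmf q. ereal (pmf q x) * (\<Sum>p\<in>A. h p * ereal (pmf (F x) p)))"
proof -
  have "(\<Sum>p\<in>A. h p * ereal (pmf (q \<bind> F) p)) =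
        (\<Sum>p\<in>A. h p * (\<Sum>x\<in>set_pmf q. ereal (pmf q x * pmf (F x) p)))"
    using assms(1) by (simp add: pmf_bind_finite)
  also have "\<dots> = (\<Sum>p\<in>A. \<Sum>x\<in>set_pmf q. h p * ereal (pmf q x * pmf (F x) p))"
    by (intro sum.cong sum_ereal_right_distrib) auto
  also have "\<dots> = (\<Sum>x\<in>set_pmf q. \<Sum>p\<in>A. ereal (pmf q x) * (h p * ereal (pmf (F x) p)))"
    by (subst sum.swap) (simp add: mult_ac flip: times_ereal.simps(1))
  also have "\<dots> = (\<Sum>x\<in>set_pmf q. ereal (pmf q x) * (\<Sum>p\<in>A. h p * ereal (pmf (F x) p)))"
    using assms(2) by (intro sum.cong sum_ereal_right_distrib[symmetric]) (auto intro!: ereal_0_le_mult)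
  finally show ?thesis .
qed

lemma partial_dists_bind:
  assumes fin: "finite (set_pmf q)"
    and F: "\<And>x. x \<in> set_pmf q \<Longrightarrow> F x \<in> partial_dists \<delta> x0 k n d j"
  shows "q \<bind> F \<in> partial_dists \<delta> x0 k n d j"
proof -
  have avg: "(\<Sum>p\<in>A. pmf (q \<bind> F) p) = (\<Sum>x\<in>set_pmf q. pmf q x * (\<Sum>p\<in>A. pmf (F x) p))" for A
    using sum_pmf_bind[OF fin, of "\<lambda>_. 1"] by simp
  have const: "c = (\<Sum>x\<in>set_pmf q. pmf q x * c)" for c
    using fin by (simp add: sum_pmf_eq_1 flip: sum_distrib_right)
  have "set_pmf (q \<bind> F) \<subseteq> data_points n d"
    using F by (fastforce simp: partial_dists_def data_dists_def)
  moreover have "(\<Sum>p\<in>nbhd \<delta> x0 n d (j - 1). pmf (q \<bind> F) p) \<le> (real k - 1) / real n"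
    unfolding avg using F
    by (subst const, intro sum_mono mult_left_mono) (auto simp: partial_dists_def)
  moreover have "real k / real n \<le> (\<Sum>p\<in>nbhd \<delta> x0 n d j. pmf (q \<bind> F) p)"
    unfolding avg using F
    by (subst const, intro sum_mono mult_left_mono) (auto simp: partial_dists_def)
  ultimately show ?thesis
    by (simp add: partial_dists_def data_dists_def)
qed

section \<open>The partial estimator as a quasiconcave function\<close>

text \<open>The denominator of the partial estimator when it is written as a ratio.\<close>

definition nbhd_weight ::
  "('x \<times> 'y \<Rightarrow> 'x \<Rightarrow> real) \<Rightarrow> ('x \<Rightarrow> 'x \<Rightarrow> real) \<Rightarrow> 'x \<Rightarrow> nat \<Rightarrow> (nat \<Rightarrow> 'x \<times> 'y) \<Rightarrow> nat \<Rightarrow>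
   ('x \<times> 'y) pmf \<Rightarrow> real" where
  "nbhd_weight \<delta> w x0 n d j D = (\<Sum>p\<in>nbhd \<delta> x0 n d j. w (fst p) x0 * pmf D p)"

context
  fixes n k :: nat and d :: "nat \<Rightarrow> 'x \<times> 'y" and \<delta> :: "'x \<times> 'y \<Rightarrow> 'x \<Rightarrow> real"
    and w :: "'x \<Rightarrow> 'x \<Rightarrow> real" and L :: "'z \<Rightarrow> 'y \<Rightarrow> ereal" and x0 :: 'x
  assumes n: "n \<ge> 1" and k: "k \<ge> 1"
    and w: "\<And>p. p \<in> data_points n d \<Longrightarrow> w (fst p) x0 > 0"
    and L: "\<And>z y. L z y \<ge> 0"
begin

lemma nbhd_cost_nonneg: "p \<in> nbhd \<delta> x0 n d j \<Longrightarrow> 0 \<le> ereal (w (fst p) x0) * L z (snd p)"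
  using w[OF subsetD[OF nbhd_subset_data_points], of p] L by (intro ereal_0_le_mult) (auto intro: less_imp_le)

lemma nbhd_weight_pos:
  assumes D: "D \<in> partial_dists \<delta> x0 k n d j"
  shows "0 < nbhd_weight \<delta> w x0 n d j D"
proof -
  let ?N = "nbhd \<delta> x0 n d j"
  have "0 < real k / real n" using n k by simp
  also have "\<dots> \<le> (\<Sum>p\<in>?N. pmf D p)" using D by (simp add: partial_dists_def)
  finally obtain p where p: "p \<in> ?N" "0 < pmf D p"
    by (metis less_irrefl not_less pmf_nonneg order_antisym sum.neutral)
  have w': "w (fst p) x0 > 0" if "p \<in> ?N" for p
    using that by (intro w subsetD[OF nbhd_subset_data_points])
  show ?thesis
    unfolding nbhd_weight_def using p w'
    by (intro sum_pos2[of _ p]) (auto simp: finite_nbhd less_imp_le)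
qed

lemma partial_estimator_infeasible:
  assumes D: "D \<in> data_dists n d" "D \<notin> partial_dists \<delta> x0 k n d j"
  shows "partial_estimator \<delta> w L x0 k n d j D z = -\<infinity>"
proof -
  have "D \<in> partial_dists \<delta> x0 k n d j"
    if s: "0 < s" and eq: "\<forall>p\<in>data_points n d. s * pmf D p = P p"
      and lo: "(\<Sum>p\<in>nbhd \<delta> x0 n d j. P p) \<ge> real k / real n * s"
      and up: "(\<Sum>p\<in>nbhd \<delta> x0 n d (j - 1). P p) \<le> (real k - 1) / real n * s"
    for s and P :: "'x \<times> 'y \<Rightarrow> real"
  proof -
    have "(\<Sum>p\<in>nbhd \<delta> x0 n d i. P p) = (\<Sum>p\<in>nbhd \<delta> x0 n d i. pmf D p) * s" for i
      unfolding sum_distrib_right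
      by (intro sum.cong refl) (metis eq mult.commute subsetD[OF nbhd_subset_data_points])
    then show ?thesis
      using mult_right_le_imp_le[OF _ s] lo up D(1) by (simp add: partial_dists_def del: times_divide_eq_left)
  qed
  then show ?thesis
    using D(2) unfolding partial_estimator_def
    by (subst Collect_empty_eq[THEN iffD2]) (auto simp: bot_ereal_def)
qed

text \<open>
  The constraints force \<open>P = s D\<close> on the data, and the normalization then forces \<open>s\<close> to be the
  reciprocal of the weight: the supremum is over a single value. The identity is stated without a
  division because both sides of \<open>t \<le> E(D)\<close>, multiplied by the weight, become linear in \<open>D\<close>.
\<close>

lemma partial_estimator_times_nbhd_weight:
  assumes D: "D \<in> partial_dists \<delta> x0 k n d j"
  shows "partial_estimator \<delta> w L x0 k n d j D z * ereal (nbhd_weight \<delta> w x0 n d j D) =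
         (\<Sum>p\<in>nbhd \<delta> x0 n d j. ereal (w (fst p) x0) * L z (snd p) * ereal (pmf D p))"
proof -
  let ?N = "nbhd \<delta> x0 n d"
  let ?W = "nbhd_weight \<delta> w x0 n d j D"
  let ?v = "\<Sum>(x, y)\<in>?N j. ereal (w x x0) * L z y * ereal (pmf D (x, y) / ?W)"
  have W: "0 < ?W" by (rule nbhd_weight_pos[OF D])
  have "partial_estimator \<delta> w L x0 k n d j D z = Sup {?v}"
    unfolding partial_estimator_def
  proof (rule arg_cong[of _ _ Sup], intro equalityI subsetI)
    fix v
    assume "v \<in> {(\<Sum>(x, y)\<in>?N j. ereal (w x x0) * L z y * ereal (P (x, y))) | s P.
        0 < s \<and> (\<forall>p\<in>data_points n d. 0 \<le> P p) \<and>
        (\<forall>p\<in>data_points n d. s * pmf D p = P p) \<and> (\<Sum>p\<in>data_points n d. P p) = s \<and>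
        (\<Sum>(x, y)\<in>?N j. w x x0 * P (x, y)) = 1 \<and>
        (\<Sum>p\<in>?N j. P p) \<ge> real k / real n * s \<and>
        (\<Sum>p\<in>?N (j - 1). P p) \<le> (real k - 1) / real n * s}"
    then obtain s P where v: "v = (\<Sum>(x, y)\<in>?N j. ereal (w x x0) * L z y * ereal (P (x, y)))"
      and P: "\<forall>p\<in>data_points n d. s * pmf D p = P p"
      and one: "(\<Sum>(x, y)\<in>?N j. w x x0 * P (x, y)) = 1"
      by blast
    have P': "P p = s * pmf D p" if "p \<in> ?N j" for p
      using P that nbhd_subset_data_points by fastforce
    have "(\<Sum>(x, y)\<in>?N j. w x x0 * P (x, y)) = s * ?W"
      unfolding nbhd_weight_def sum_distrib_left
      by (intro sum.cong) (auto simp: P' mult_ac)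
    then have "s = 1 / ?W" using one W by (simp add: field_simps)
    then show "v \<in> {?v}"
      unfolding v by (auto intro!: sum.cong simp: P')
  next
    fix v assume "v \<in> {?v}"
    moreover have "(\<Sum>(x, y)\<in>?N j. w x x0 * (pmf D (x, y) / ?W)) = ?W / ?W"
      unfolding nbhd_weight_def sum_divide_distrib by (simp add: case_prod_unfold)
    moreover have "(\<Sum>p\<in>data_points n d. pmf D p) = 1"
      using D by (intro sum_pmf_eq_1) (auto simp: finite_data_points partial_dists_def data_dists_def)
    moreover have "(real k / real n) * (1 / ?W) \<le> (\<Sum>p\<in>?N j. pmf D p / ?W)"
      and "(\<Sum>p\<in>?N (j - 1). pmf D p / ?W) \<le> ((real k - 1) / real n) * (1 / ?W)"
      using D W unfolding sum_divide_distrib[symmetric]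
      by (simp_all add: partial_dists_def divide_right_mono flip: divide_divide_eq_left)
    ultimately show "v \<in> {(\<Sum>(x, y)\<in>?N j. ereal (w x x0) * L z y * ereal (P (x, y))) | s P.
        0 < s \<and> (\<forall>p\<in>data_points n d. 0 \<le> P p) \<and>
        (\<forall>p\<in>data_points n d. s * pmf D p = P p) \<and> (\<Sum>p\<in>data_points n d. P p) = s \<and>
        (\<Sum>(x, y)\<in>?N j. w x x0 * P (x, y)) = 1 \<and>
        (\<Sum>p\<in>?N j. P p) \<ge> real k / real n * s \<and>
        (\<Sum>p\<in>?N (j - 1). P p) \<le> (real k - 1) / real n * s}"
      using W D
      by (intro CollectI exI[of _ "1 / ?W"] exI[of _ "\<lambda>p. pmf D p / ?W"])
         (auto simp flip: sum_divide_distrib)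
  qed
  then have "partial_estimator \<delta> w L x0 k n d j D z * ereal ?W = ?v * ereal ?W" by simp
  also have "\<dots> = (\<Sum>p\<in>?N j. ereal (w (fst p) x0) * L z (snd p) * ereal (pmf D p / ?W) * ereal ?W)"
    using W by (subst sum_distrib_right_ereal) (auto simp: case_prod_unfold)
  also have "\<dots> = (\<Sum>p\<in>?N j. ereal (w (fst p) x0) * L z (snd p) * ereal (pmf D p))"
    using W by (intro sum.cong) (auto simp: mult.assoc)
  finally show ?thesis .
qed

lemma partial_estimator_nonneg:
  assumes D: "D \<in> partial_dists \<delta> x0 k n d j"
  shows "0 \<le> partial_estimator \<delta> w L x0 k n d j D z"
proof -
  have "0 \<le> partial_estimator \<delta> w L x0 k n d j D z * ereal (nbhd_weight \<delta> w x0 n d j D)"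
    unfolding partial_estimator_times_nbhd_weight[OF D]
    by (intro sum_nonneg ereal_0_le_mult nbhd_cost_nonneg) auto
  then show ?thesis
    using nbhd_weight_pos[OF D] by (simp add: ereal_zero_le_0_iff)
qed

text \<open>
  On feasible distributions, \<open>t \<le> E(D)\<close> says that \<open>t\<close> times the weight of \<open>D\<close> is at most the weighted
  loss of \<open>D\<close>. Both are linear in \<open>D\<close>, so the inequality survives mixing.
\<close>

lemma partial_estimator_quasiconcave:
  assumes fin: "finite (set_pmf q)"
    and F: "\<And>x. x \<in> set_pmf q \<Longrightarrow> F x \<in> partial_dists \<delta> x0 k n d j"
    and t: "0 \<le> t" "\<And>x. x \<in> set_pmf q \<Longrightarrow> t \<le> partial_estimator \<delta> w L x0 k n d j (F x) z"
  shows "t \<le> partial_estimator \<delta> w L x0 k n d j (q \<bind> F) z"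
proof -
  let ?N = "nbhd \<delta> x0 n d j"
  let ?E = "\<lambda>D. partial_estimator \<delta> w L x0 k n d j D z"
  let ?W = "nbhd_weight \<delta> w x0 n d j"
  note Q = partial_dists_bind[OF fin F]
  have W: "0 < ?W (F x)" if "x \<in> set_pmf q" for x
    using that by (intro nbhd_weight_pos F)
  have WQ: "0 < ?W (q \<bind> F)"
    by (intro nbhd_weight_pos partial_dists_bind fin F)
  have "t * ereal (?W (q \<bind> F)) = t * (\<Sum>x\<in>set_pmf q. ereal (pmf q x * ?W (F x)))"
    using fin by (simp add: nbhd_weight_def sum_pmf_bind)
  also have "\<dots> = (\<Sum>x\<in>set_pmf q. t * ereal (pmf q x * ?W (F x)))"
    using W by (intro sum_ereal_right_distrib) (simp add: less_imp_le)
  also have "\<dots> = (\<Sum>x\<in>set_pmf q. ereal (pmf q x) * (t * ereal (?W (F x))))"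
    by (simp add: mult_ac flip: times_ereal.simps(1))
  also have "\<dots> \<le> (\<Sum>x\<in>set_pmf q. ereal (pmf q x) * (?E (F x) * ereal (?W (F x))))"
    using t W by (intro sum_mono ereal_mult_left_mono ereal_mult_right_mono) (auto simp: less_imp_le)
  also have "\<dots> = (\<Sum>x\<in>set_pmf q. ereal (pmf q x) *
                 (\<Sum>p\<in>?N. ereal (w (fst p) x0) * L z (snd p) * ereal (pmf (F x) p)))"
    using partial_estimator_times_nbhd_weight[OF F] by (intro sum.cong) auto
  also have "\<dots> = (\<Sum>p\<in>?N. ereal (w (fst p) x0) * L z (snd p) * ereal (pmf (q \<bind> F) p))"
    by (rule sum_pmf_bind_ereal[OF fin nbhd_cost_nonneg, symmetric])
  also have "\<dots> = ?E (q \<bind> F) * ereal (?W (q \<bind> F))"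
    by (rule partial_estimator_times_nbhd_weight[OF Q, symmetric])
  finally show ?thesis
    using WQ ereal_mult_le_mult_iff[of "ereal (?W (q \<bind> F))"]
    by (simp add: mult.commute[of _ "ereal (?W (q \<bind> F))"])
qed

section \<open>The disappointment bound\<close>

lemma exp_ereal_nonneg: "0 \<le> exp_ereal t"
  by (cases t) (auto simp: exp_ereal_def)

lemma exp_ereal_ereal [simp]: "exp_ereal (ereal x) = ereal (exp x)"
  by (simp add: exp_ereal_def)

lemma exp_ereal_mono: "s \<le> t \<Longrightarrow> exp_ereal s \<le> exp_ereal t"
  by (cases s; cases t) (auto simp: exp_ereal_def)

text \<open>
  The mean empirical distribution \<open>Q\<close> of a conditioned resample serves as the witness: it lies
  outside the ball of radius \<open>r\<close>, and it competes in the infimum that defines the partial radius.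
\<close>

lemma partial_disappointment_bound:
  assumes j: "j \<in> {1..n}"
  shows "ereal (measure_pmf.prob (Pi_pmf {..<n} undefined (\<lambda>_. train_dist n d))
            {x. partial_estimator \<delta> w L x0 k n d j (empirical_dist n x) z > robust_cost \<delta> w L x0 k n d r z})
         \<le> exp_ereal (- (ereal (real n) * max (ereal r) (partial_radius \<delta> x0 k n d j)))"
proof -
  let ?P = "train_dist n d"
  let ?E = "\<lambda>D. partial_estimator \<delta> w L x0 k n d j D z"
  let ?c = "robust_cost \<delta> w L x0 k n d r z"
  define R where "R = Pi_pmf {..<n} undefined (\<lambda>_. ?P)"
  define G where "G = {x. ?E (empirical_dist n x) > ?c}"
  have finP: "finite (set_pmf ?P)" using n by (simp add: set_train_dist finite_data_points)
  have setR: "set_pmf R = PiE_dflt {..<n} undefined (\<lambda>_. data_points n d)"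
    using n by (simp add: R_def set_Pi_pmf comp_def set_train_dist)
  have finR: "finite (set_pmf R)"
    unfolding setR using finite_data_points by blast
  show ?thesis
  proof (cases "set_pmf R \<inter> G = {}")
    case True
    then have "measure_pmf.prob R G = 0"
      by (simp add: measure_pmf_zero_iff)
    then show ?thesis
      unfolding R_def[symmetric] G_def[symmetric] by (simp add: exp_ereal_nonneg flip: zero_ereal_def)
  next
    case False
    define q where "q = cond_pmf R G"
    define Q where "Q = q \<bind> empirical_dist n"
    define b where "b = measure_pmf.expectation Q (\<lambda>p. ln (pmf Q p / pmf ?P p))"
    have setq: "set_pmf q = set_pmf R \<inter> G"
      unfolding q_def using False by (rule set_cond_pmf)
    have finq: "finite (set_pmf q)" using finR setq by simp
    have data: "empirical_dist n x \<in> data_dists n d" if "x \<in> set_pmf q" for x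
      using that n unfolding setq setR by (auto simp: data_dists_def set_empirical_dist PiE_dflt_def)
    have above: "?c < ?E (empirical_dist n x)" if "x \<in> set_pmf q" for x
      using that unfolding setq G_def by simp
    have part: "empirical_dist n x \<in> partial_dists \<delta> x0 k n d j" if "x \<in> set_pmf q" for x
      using partial_estimator_infeasible[OF data[OF that]] above[OF that] by fastforce
    have Q_part: "Q \<in> partial_dists \<delta> x0 k n d j"
      unfolding Q_def using finq part by (rule partial_dists_bind)
    then have Q_data: "Q \<in> data_dists n d"
      by (simp add: partial_dists_def)
    \<comment> \<open>Quasiconcavity preserves weak lower bounds only. Since \<open>q\<close> has finite support, the strict
       bound by the robust cost can be strengthened to a weak bound by a larger number.\<close>
    define t where "t = Min ((\<lambda>x. ?E (empirical_dist n x)) ` set_pmf q)"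
    have "?c < t"
      unfolding t_def using finq above by (subst Min_gr_iff) (auto simp: set_pmf_not_empty)
    also have "t \<le> ?E Q"
      unfolding Q_def
    proof (rule partial_estimator_quasiconcave[OF finq part])
      show "0 \<le> t"
        unfolding t_def using finq partial_estimator_nonneg[OF part]
        by (subst Min_ge_iff) (auto simp: set_pmf_not_empty)
    qed (use finq in \<open>auto simp: t_def\<close>)
    also have "\<dots> \<le> estimator \<delta> w L x0 k n d Q z"
      unfolding estimator_def using j by (intro Max_ge) auto
    finally have Q_above: "?c < estimator \<delta> w L x0 k n d Q z" .
    have dist: "bootstrap_distance n d Q ?P = ereal b"
      using Q_data n unfolding bootstrap_distance_def b_def
      by (subst integral_measure_pmf_real[of "data_points n d"])
         (auto simp: data_dists_def set_train_dist finite_data_points mult.commute)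
    have "r < b"
    proof (rule ccontr)
      assume "\<not> r < b"
      then have "estimator \<delta> w L x0 k n d Q z \<le> ?c"
        unfolding robust_cost_def using Q_data dist by (intro Sup_upper) auto
      then show False using Q_above by simp
    qed
    moreover have "partial_radius \<delta> x0 k n d j \<le> ereal b"
      unfolding partial_radius_def using Q_part dist by (intro Inf_lower) force
    ultimately have "max (ereal r) (partial_radius \<delta> x0 k n d j) \<le> ereal b"
      by simp
    then have "ereal (real n) * max (ereal r) (partial_radius \<delta> x0 k n d j) \<le> ereal (real n) * ereal b"
      by (intro ereal_mult_left_mono) auto
    then have "exp_ereal (- ereal (real n * b)) \<le>
               exp_ereal (- (ereal (real n) * max (ereal r) (partial_radius \<delta> x0 k n d j)))"
      by (intro exp_ereal_mono) (simp del: uminus_ereal.simps)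
    moreover have "measure_pmf.prob R G \<le> exp (- (real n * b))"
      using conditioned_sample_entropy_bound[OF n finP, of G] False
      unfolding R_def b_def Q_def q_def by simp
    ultimately show ?thesis
      unfolding R_def[symmetric] G_def[symmetric]
      by (metis ereal_less_eq(3) exp_ereal_ereal order_trans uminus_ereal.simps(1))
  qed
qed

end

theorem theorem6:
  fixes \<Omega> :: "('x::euclidean_space \<times> 'y::euclidean_space) set"
    and d :: "nat \<Rightarrow> 'x \<times> 'y"
    and \<delta> :: "'x \<times> 'y \<Rightarrow> 'x \<Rightarrow> real"
    and w :: "'x \<Rightarrow> 'x \<Rightarrow> real"
    and L :: "'z::euclidean_space \<Rightarrow> 'y \<Rightarrow> ereal"
    and x0 :: 'x and zr :: 'z and n k :: nat and r :: real
  assumes "n \<ge> 1"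
    and "\<And>i. i \<in> {1..n} \<Longrightarrow> d i \<in> \<Omega>"
    and "\<And>p. p \<in> \<Omega> \<Longrightarrow> \<delta> p x0 \<ge> 0"
    and "\<And>p q. p \<in> \<Omega> \<Longrightarrow> q \<in> \<Omega> \<Longrightarrow> \<delta> p x0 = \<delta> q x0 \<longleftrightarrow> p = q"
    and "\<And>x y. (x, y) \<in> \<Omega> \<Longrightarrow> w x x0 > 0"
    and "\<And>z y. L z y \<ge> 0"
    and "\<And>y. ereal_convex (\<lambda>z. L z y)"
    and "\<And>z. L z \<in> borel_measurable borel"
    and "k \<in> {1..n}"
    and "r \<ge> 0"
    and "is_arg_min (robust_cost \<delta> w L x0 k n d r) (\<lambda>z. True) zr"
  shows "ereal (\<P>(\<omega> in bootstrap_measure n d.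
            estimator \<delta> w L x0 k n d (empirical_dist n \<omega>) zr > robust_cost \<delta> w L x0 k n d r zr))
         \<le> disappointment_bound \<delta> x0 k n d r"
proof -
  let ?c = "robust_cost \<delta> w L x0 k n d r zr"
  let ?R = "Pi_pmf {..<n} undefined (\<lambda>_. train_dist n d)"
  let ?G = "\<lambda>j. {x. partial_estimator \<delta> w L x0 k n d j (empirical_dist n x) zr > ?c}"
  have n: "n \<ge> 1" and k: "k \<ge> 1" using assms(1,9) by auto
  have w: "w (fst p) x0 > 0" if "p \<in> data_points n d" for p
    using that assms(2) assms(5)[of "fst p" "snd p"] by (auto simp: data_points_def)
  have "\<P>(\<omega> in bootstrap_measure n d. estimator \<delta> w L x0 k n d (empirical_dist n \<omega>) zr > ?c)
        \<le> measure_pmf.prob ?R {x. estimator \<delta> w L x0 k n d (empirical_dist n x) zr > ?c}"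
    unfolding bootstrap_measure_def
  proof (rule prob_iid_sequence_le_Pi_pmf)
    show "finite (set_pmf (train_dist n d))"
      using n by (simp add: set_train_dist finite_data_points)
    fix \<omega> \<omega>' :: "nat \<Rightarrow> 'x \<times> 'y" assume "\<And>i. i < n \<Longrightarrow> \<omega> i = \<omega>' i"
    then have "empirical_dist n \<omega> = empirical_dist n \<omega>'"
      unfolding empirical_dist_def using n
      by (intro map_pmf_cong) (auto simp: set_pmf_of_set lessThan_empty_iff)
    then show "(estimator \<delta> w L x0 k n d (empirical_dist n \<omega>) zr > ?c) =
               (estimator \<delta> w L x0 k n d (empirical_dist n \<omega>') zr > ?c)"
      by simp
  qed
  also have "{x. estimator \<delta> w L x0 k n d (empirical_dist n x) zr > ?c} = (\<Union>j\<in>{1..n}. ?G j)"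
    using n by (auto simp: estimator_def Max_gr_iff)
  also have "measure_pmf.prob ?R \<dots> \<le> (\<Sum>j=1..n. measure_pmf.prob ?R (?G j))"
    by (intro measure_pmf.finite_measure_subadditive_finite) auto
  finally have "ereal (\<P>(\<omega> in bootstrap_measure n d.
      estimator \<delta> w L x0 k n d (empirical_dist n \<omega>) zr > ?c)) \<le> (\<Sum>j=1..n. ereal (measure_pmf.prob ?R (?G j)))"
    by simp
  also have "\<dots> \<le> disappointment_bound \<delta> x0 k n d r"
    unfolding disappointment_bound_def
    by (intro sum_mono partial_disappointment_bound n k w assms(6)) auto
  finally show ?thesis .
qed

end
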